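(* For each block configuration $\mathcal{B}$ in $\mathbb{F}_2^d$ there is an extended formulation of $\mathrm{CTP}(\mathcal{B})$ of size at most $2^{\operatorname{rank}(\mathcal{B})}\cdot\operatorname{size}(\mathcal{B})$.
   Context: An extension of a polytope $P$ is a polytope $Q$ such that $P$ is the image of $Q$ under some affine map. An extended formulation of $P$ is a description of an extension of $P$ by means of linear equations and linear inequalities; its size is the number of inequalities it comprises (equations are not counted). $\mathbb{F}_2$ is the field with two elements. A block configuration in $\mathbb{F}_2^d$ ($d\ge1$) is a sequence $\mathcal{B}=(\mathcal{B}(1),\dots,\mathcal{B}(n))$ with $n\ge2$ of non-empty subsets (blocks) $\mathcal{B}(i)\subseteq\mathbb{F}_2^d$; $\operatorname{size}(\mathcal{B})=\sum_i|\mathcal{B}(i)|$, and $\operatorname{rank}(\mathcal{B})$ is the dimension of the linear span of $\mathcal{B}(1)\cup\dots\cup\mathcal{B}(n)$. A cyclic transversal of $\mathcal{B}$ is a sequence $\xi=(\xi(1),\dots,\xi(n))$ with $\xi(i)\in\mathcal{B}(i)$ and $\sum_{i=1}^n\xi(i)=0$ in $\mathbb{F}_2^d$. Its incidence vector is $x=(x^1,\dots,x^n)$, $x^i\in\{0,1\}^{\mathcal{B}(i)}$, with $x^i_\omega=1$ iff $\xi(i)=\omega$. The cyclic transversal polytope $\mathrm{CTP}(\mathcal{B})\subseteq\mathbb{R}^{\mathcal{B}(1)}\times\cdots\times\mathbb{R}^{\mathcal{B}(n)}$ is the convex hull of the incidence vectors of all cyclic transversals of $\mathcal{B}$. *)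

theory Defs
  imports "HOL-Analysis.Analysis" "HOL-Analysis.Finite_Function_Topology" "HOL-Library.Z2"
begin

(* The field with two elements is the type bit of HOL-Library.Z2, so F_2^d is the type bit ^ 'd.
   Finiteness of this type guarantees that card counts blocks correctly. *)

instance bit :: finite
proof
  have "(UNIV :: bit set) \<subseteq> {0, 1}"
    by (auto intro: bit.exhaust)
  then show "finite (UNIV :: bit set)"
    by (rule finite_subset) simp
qed


section \<open>Extended formulations\<close>

(* The library's notions of convex hull, polytope and linear map need a real vector space as a type,
   while the dimensions here vary inside the statement. We therefore realize the coordinate space
   R^I as the subspace of those finitely supported functions in 'i \<Rightarrow>\<^sub>0 real
   that vanish outside I. *)

definition coord_space :: "'i set \<Rightarrow> ('i \<Rightarrow>\<^sub>0 real) set" where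
  "coord_space I = {x. Poly_Mapping.keys x \<subseteq> I}"

definition affine_map :: "('a::real_vector \<Rightarrow> 'b::real_vector) \<Rightarrow> bool" where
  "affine_map f \<longleftrightarrow> (\<exists>L c. linear L \<and> f = (\<lambda>y. L y + c))"

definition extension_of :: "'a::real_vector set \<Rightarrow> 'b::real_vector set \<Rightarrow> bool" where
  "extension_of Q P \<longleftrightarrow> polytope Q \<and> (\<exists>f. affine_map f \<and> f ` Q = P)"

(* A pair (a, b) encodes the equation a_0 y_0 + ... + a_{m-1} y_{m-1} = b in the first list and the
   inequality a_0 y_0 + ... + a_{m-1} y_{m-1} \<le> b in the second one, where m = num_vars;
   the values of a outside {..<m} are irrelevant. *)

record linear_system =
  num_vars :: nat
  equations :: "((nat \<Rightarrow> real) \<times> real) list"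
  inequalities :: "((nat \<Rightarrow> real) \<times> real) list"

definition solution_set :: "linear_system \<Rightarrow> (nat \<Rightarrow>\<^sub>0 real) set" where
  "solution_set S = {y \<in> coord_space {..<num_vars S}.
     (\<forall>(a, b) \<in> set (equations S).
        (\<Sum>j<num_vars S. a j * Poly_Mapping.lookup y j) = b) \<and>
     (\<forall>(a, b) \<in> set (inequalities S).
        (\<Sum>j<num_vars S. a j * Poly_Mapping.lookup y j) \<le> b)}"

definition extended_formulation :: "linear_system \<Rightarrow> 'a::real_vector set \<Rightarrow> bool" where
  "extended_formulation S P \<longleftrightarrow> extension_of (solution_set S) P"

definition formulation_size :: "linear_system \<Rightarrow> nat" where
  "formulation_size S = length (inequalities S)"


section \<open>Cyclic transversal polytopes\<close>

(* Sequences are lists, so the positions 1, ..., n become 0, ..., n - 1. *)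

definition block_configuration :: "(bit ^ 'd) set list \<Rightarrow> bool" where
  "block_configuration \<B> \<longleftrightarrow> length \<B> \<ge> 2 \<and> (\<forall>i < length \<B>. \<B> ! i \<noteq> {})"

definition config_size :: "(bit ^ 'd) set list \<Rightarrow> nat" where
  "config_size \<B> = (\<Sum>i<length \<B>. card (\<B> ! i))"

definition config_rank :: "(bit ^ 'd) set list \<Rightarrow> nat" where
  "config_rank \<B> = vec.dim (vec.span (\<Union>i<length \<B>. \<B> ! i))"

definition cyclic_transversals :: "(bit ^ 'd) set list \<Rightarrow> (bit ^ 'd) list set" where
  "cyclic_transversals \<B> =
     {\<xi>. length \<xi> = length \<B> \<and> (\<forall>i < length \<B>. \<xi> ! i \<in> \<B> ! i) \<and>
        (\<Sum>i<length \<B>. \<xi> ! i) = 0}"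

(* The coordinate x^i_\<omega> has index (i, \<omega>). The ambient space
   R^{B(1)} \<times> ... \<times> R^{B(n)} is coord_space of the pairs (i, \<omega>) with
   \<omega> in the i-th block; see CTP_subset_coord_space below. *)

definition incidence_vector :: "(bit ^ 'd) list \<Rightarrow> (nat \<times> (bit ^ 'd)) \<Rightarrow>\<^sub>0 real" where
  "incidence_vector \<xi> =
     Abs_poly_mapping (\<lambda>(i, \<omega>). if i < length \<xi> \<and> \<xi> ! i = \<omega> then 1 else 0)"

definition CTP :: "(bit ^ 'd) set list \<Rightarrow> ((nat \<times> (bit ^ 'd)) \<Rightarrow>\<^sub>0 real) set" where
  "CTP \<B> = convex hull (incidence_vector ` cyclic_transversals \<B>)"

lemma lookup_incidence_vector:
  "Poly_Mapping.lookup (incidence_vector \<xi>) (i, \<omega>) =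
     (if i < length \<xi> \<and> \<xi> ! i = \<omega> then 1 else 0)"
proof -
  let ?f = "\<lambda>(i, \<omega>). if i < length \<xi> \<and> \<xi> ! i = \<omega> then 1 else (0::real)"
  have "{k. ?f k \<noteq> 0} \<subseteq> (\<lambda>i. (i, \<xi> ! i)) ` {..<length \<xi>}"
    by (auto split: if_splits)
  then have "finite {k. ?f k \<noteq> 0}"
    by (rule finite_subset) simp
  then show ?thesis
    unfolding incidence_vector_def by (subst lookup_Abs_poly_mapping) auto
qed

lemma lookup_scaleR_poly_mapping:
  fixes x :: "'i \<Rightarrow>\<^sub>0 real"
  shows "Poly_Mapping.lookup (r *\<^sub>R x) k = r * Poly_Mapping.lookup x k"
proof -
  have "{i. r *\<^sub>R Poly_Mapping.lookup x i \<noteq> 0} \<subseteq> Poly_Mapping.keys x"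
    by (auto simp: in_keys_iff)
  then have "finite {i. r *\<^sub>R Poly_Mapping.lookup x i \<noteq> 0}"
    by (rule finite_subset) simp
  then show ?thesis
    unfolding scaleR_poly_mapping_def by (subst lookup_Abs_poly_mapping) auto
qed

lemma CTP_subset_coord_space:
  fixes \<B> :: "(bit ^ 'd) set list"
  shows "CTP \<B> \<subseteq> coord_space (SIGMA i:{..<length \<B>}. \<B> ! i)"
proof -
  let ?I = "SIGMA i:{..<length \<B>}. \<B> ! i"
  have char: "x \<in> coord_space ?I \<longleftrightarrow> (\<forall>k. k \<notin> ?I \<longrightarrow> Poly_Mapping.lookup x k = 0)"
    for x :: "(nat \<times> (bit ^ 'd)) \<Rightarrow>\<^sub>0 real"
    by (force simp: coord_space_def in_keys_iff)
  have "convex (coord_space ?I)"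
    by (rule convexI) (simp add: char lookup_add lookup_scaleR_poly_mapping)
  moreover have "incidence_vector ` cyclic_transversals \<B> \<subseteq> coord_space ?I"
    by (auto simp: char lookup_incidence_vector cyclic_transversals_def)
  ultimately show ?thesis
    unfolding CTP_def by (simp add: hull_minimal)
qed

end

theory Submission
  imports Defs
begin

text \<open>
  A cyclic transversal is a path in a layered network that keeps track of partial sums.  Let
  \<open>V\<close> be the linear span of the blocks.  The nodes are the pairs \<open>(k, s)\<close> with
  \<open>k \<le> n\<close> and \<open>s \<in> V\<close>, and choosing \<open>\<omega>\<close> in the block at
  position \<open>i\<close> means traversing the arc \<open>(i, s, \<omega>)\<close> from
  \<open>(i, s)\<close> to \<open>(i + 1, s + \<omega>)\<close>.  Starting at \<open>(0, 0)\<close>, a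
  transversal is cyclic iff its path ends in \<open>(n, 0)\<close>.

  The extension is the polytope of unit flows from \<open>(0, 0)\<close> to \<open>(n, 0)\<close>: one
  nonnegativity constraint per arc and one equation per node.  The number of arcs is the cardinality
  of \<open>V\<close> times the size of the configuration, and a space of dimension \<open>r\<close> over the
  field with two elements has \<open>2 ^ r\<close> elements.  Forgetting the \<open>s\<close> of each arc maps
  the flow along a path to the incidence vector of the transversal.  So everything rests on the fact
  that the unit flows are exactly the convex combinations of path flows
  (\<open>flow_decomposition\<close>).

  The layers allow an explicit decomposition: read the flow as a Markov chain that leaves a node along
  an arc with probability the flow on the arc divided by the total flow out of the node, and give every
  path its probability.  Flow conservation is what makes the arc marginals of this chain equal to the
  given flow; it enters through a telescoping sum along each path (\<open>excess_path_flow\<close>).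
\<close>

section \<open>Extended formulations in standard form\<close>

lemma linear_form_combination:
  "(\<Sum>j<m. a j * Poly_Mapping.lookup (u *\<^sub>R x + v *\<^sub>R y) j) =
   u * (\<Sum>j<m. a j * Poly_Mapping.lookup x j) + v * (\<Sum>j<m. a j * Poly_Mapping.lookup y j)"
  by (simp add: lookup_add lookup_scaleR_poly_mapping sum_distrib_left sum.distrib algebra_simps)

lemma convex_coord_space: "convex (coord_space I)"
proof -
  have char: "x \<in> coord_space I \<longleftrightarrow> (\<forall>k. k \<notin> I \<longrightarrow> Poly_Mapping.lookup x k = 0)"
    for x :: "'a \<Rightarrow>\<^sub>0 real"
    by (force simp: coord_space_def in_keys_iff)
  show ?thesis
    by (rule convexI) (simp add: char lookup_add lookup_scaleR_poly_mapping)
qed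

lemma convex_solution_set: "convex (solution_set S)"
proof (rule convexI)
  fix x y and u v :: real
  assume x: "x \<in> solution_set S" and y: "y \<in> solution_set S"
    and uv: "0 \<le> u" "0 \<le> v" "u + v = 1"
  have "u *\<^sub>R x + v *\<^sub>R y \<in> coord_space {..<num_vars S}"
    using x y uv convex_coord_space unfolding solution_set_def by (auto intro: convexD)
  moreover have "u * b + v * b = b" for b :: real
    using uv by (simp flip: distrib_right)
  ultimately show "u *\<^sub>R x + v *\<^sub>R y \<in> solution_set S"
    using x y uv unfolding solution_set_def
    by (fastforce simp: linear_form_combination intro: convex_bound_le)
qed

lemma lookup_sum_scaleR_single:
  fixes c :: "'i \<Rightarrow> real"
  assumes "finite I"
  shows "Poly_Mapping.lookup (\<Sum>i\<in>I. c i *\<^sub>R Poly_Mapping.single i 1) k = (if k \<in> I then c k else 0)"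
  using assms
  by (simp add: lookup_sum lookup_scaleR_poly_mapping lookup_single when_def if_distrib cong: if_cong)

text \<open>The passage from a combinatorial description to a linear system with variables numbered by
  \<open>nat\<close>.  If the nonnegative solutions of the equations \<open>c k \<bullet> z = b k\<close> on
  \<open>A\<close> are the convex combinations of the points \<open>v x\<close>, then the solution set is a
  polytope, and a linear map, given by the images \<open>w a\<close> of the unit vectors, takes it to the
  hull of the images of the \<open>v x\<close>.  Proving the decomposition directly yields the
  polytope property without an appeal to boundedness and finite dimension of the ambient space.\<close>

lemma extended_formulation_standard_form:
  fixes c :: "'k \<Rightarrow> 'a \<Rightarrow> real" and b :: "'k \<Rightarrow> real"
    and v :: "'x \<Rightarrow> 'a \<Rightarrow> real" and w :: "'a \<Rightarrow> 'b::real_vector"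
  assumes "finite A" "finite N" "finite X"
    and nonneg: "\<And>x a. x \<in> X \<Longrightarrow> a \<in> A \<Longrightarrow> v x a \<ge> 0"
    and sol: "\<And>x k. x \<in> X \<Longrightarrow> k \<in> N \<Longrightarrow> (\<Sum>a\<in>A. c k a * v x a) = b k"
    and decomp: "\<And>z. (\<And>a. a \<in> A \<Longrightarrow> z a \<ge> 0) \<Longrightarrow> (\<And>k. k \<in> N \<Longrightarrow> (\<Sum>a\<in>A. c k a * z a) = b k)
      \<Longrightarrow> \<exists>\<mu>. (\<forall>x\<in>X. \<mu> x \<ge> 0) \<and> sum \<mu> X = 1 \<and> (\<forall>a\<in>A. z a = (\<Sum>x\<in>X. \<mu> x * v x a))"
  shows "\<exists>S. extended_formulation S (convex hull ((\<lambda>x. \<Sum>a\<in>A. v x a *\<^sub>R w a) ` X)) \<and>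
             formulation_size S = card A"
proof -
  obtain g where g: "bij_betw g {..<card A} A"
    using ex_bij_betw_nat_finite[OF \<open>finite A\<close>] by (auto simp: atLeast0LessThan)
  have reindex: "(\<Sum>j<card A. h (g j)) = sum h A" for h :: "'a \<Rightarrow> 'c::comm_monoid_add"
    by (rule sum.reindex_bij_betw[OF g])
  have gA: "g j \<in> A" if "j < card A" for j
    using g that by (auto simp: bij_betw_def)
  have ginv: "\<exists>j<card A. a = g j" if "a \<in> A" for a
    using g that by (auto simp: bij_betw_def)
  obtain ks where ks: "set ks = N"
    using finite_list[OF \<open>finite N\<close>] by blast
  define S where "S = \<lparr>num_vars = card A,
      equations = map (\<lambda>k. (\<lambda>j. c k (g j), b k)) ks,
      inequalities = map (\<lambda>j. (\<lambda>j'. if j' = j then -1 else 0, 0)) [0..<card A]\<rparr>"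
  define vec where "vec z = (\<Sum>j<card A. z (g j) *\<^sub>R Poly_Mapping.single j (1::real))"
    for z :: "'a \<Rightarrow> real"
  have lookup_vec: "Poly_Mapping.lookup (vec z) j = (if j < card A then z (g j) else 0)" for z j
    unfolding vec_def by (subst lookup_sum_scaleR_single) auto
  have mem: "y \<in> solution_set S \<longleftrightarrow> y \<in> coord_space {..<card A} \<and>
      (\<forall>k\<in>N. (\<Sum>j<card A. c k (g j) * Poly_Mapping.lookup y j) = b k) \<and>
      (\<forall>j<card A. Poly_Mapping.lookup y j \<ge> 0)" for y
  proof -
    have *: "(\<Sum>j'<card A. (if j' = j then - 1 else 0) * Poly_Mapping.lookup y j') =
       - Poly_Mapping.lookup y j" if "j < card A" for j
    proof -
      have "(\<Sum>j'<card A. (if j' = j then - 1 else 0) * Poly_Mapping.lookup y j') =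
        (\<Sum>j'<card A. (if j' = j then - Poly_Mapping.lookup y j' else 0))"
        by (rule sum.cong) auto
      then show ?thesis using that by simp
    qed
    show ?thesis
      unfolding solution_set_def by (auto simp: S_def ks *)
  qed
  have Q: "solution_set S = convex hull ((\<lambda>x. vec (v x)) ` X)"
  proof
    have "vec (v x) \<in> solution_set S" if "x \<in> X" for x
    proof -
      have "vec (v x) \<in> coord_space {..<card A}"
        by (auto simp: coord_space_def in_keys_iff lookup_vec split: if_splits)
      moreover have "(\<Sum>j<card A. c k (g j) * Poly_Mapping.lookup (vec (v x)) j) = b k"
        if "k \<in> N" for k
        using sol[OF \<open>x \<in> X\<close> that] by (simp add: lookup_vec flip: reindex)
      ultimately show ?thesis
        using nonneg[OF that] gA by (simp add: mem lookup_vec)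
    qed
    then show "convex hull ((\<lambda>x. vec (v x)) ` X) \<subseteq> solution_set S"
      by (intro hull_minimal convex_solution_set) auto
  next
    show "solution_set S \<subseteq> convex hull ((\<lambda>x. vec (v x)) ` X)"
    proof
      fix y assume "y \<in> solution_set S"
      note y = this[unfolded mem]
      define z where "z a = Poly_Mapping.lookup y (the_inv_into {..<card A} g a)" for a
      have zg: "z (g j) = Poly_Mapping.lookup y j" if "j < card A" for j
        using g that unfolding z_def by (simp add: bij_betw_def the_inv_into_f_f)
      have "\<exists>\<mu>. (\<forall>x\<in>X. \<mu> x \<ge> 0) \<and> sum \<mu> X = 1 \<and> (\<forall>a\<in>A. z a = (\<Sum>x\<in>X. \<mu> x * v x a))"
      proof (rule decomp)
        show "z a \<ge> 0" if "a \<in> A" for a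
          using ginv[OF that] y zg by auto
        show "(\<Sum>a\<in>A. c k a * z a) = b k" if "k \<in> N" for k
          using y that by (simp add: zg flip: reindex)
      qed
      then obtain \<mu> where \<mu>: "\<And>x. x \<in> X \<Longrightarrow> \<mu> x \<ge> 0" "sum \<mu> X = 1"
        "\<And>a. a \<in> A \<Longrightarrow> z a = (\<Sum>x\<in>X. \<mu> x * v x a)" by blast
      have "y = (\<Sum>x\<in>X. \<mu> x *\<^sub>R vec (v x))"
      proof (rule poly_mapping_eqI)
        fix j
        show "Poly_Mapping.lookup y j = Poly_Mapping.lookup (\<Sum>x\<in>X. \<mu> x *\<^sub>R vec (v x)) j"
        proof (cases "j < card A")
          case True
          then show ?thesis
            using \<mu>(3)[OF gA[OF True]]
            by (simp add: zg lookup_sum lookup_scaleR_poly_mapping lookup_vec)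
        next
          case False
          then have "Poly_Mapping.lookup y j = 0"
            using y by (auto simp: coord_space_def in_keys_iff)
          then show ?thesis
            using False by (simp add: lookup_sum lookup_scaleR_poly_mapping lookup_vec)
        qed
      qed
      also have "\<dots> \<in> convex hull ((\<lambda>x. vec (v x)) ` X)"
        using \<open>finite X\<close> \<mu> by (intro convex_sum convex_convex_hull) (auto intro: hull_inc)
      finally show "y \<in> convex hull ((\<lambda>x. vec (v x)) ` X)" .
    qed
  qed
  define L where "L y = (\<Sum>j<card A. Poly_Mapping.lookup y j *\<^sub>R w (g j))"
    for y :: "nat \<Rightarrow>\<^sub>0 real"
  have "linear L"
    unfolding L_def
    by (rule linearI)
      (simp_all add: lookup_add lookup_scaleR_poly_mapping scaleR_add_left sum.distrib scaleR_sum_right)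
  have L_vec: "L (vec z) = (\<Sum>a\<in>A. z a *\<^sub>R w a)" for z
    unfolding L_def by (simp add: lookup_vec flip: reindex)
  have "L ` solution_set S = convex hull ((\<lambda>x. \<Sum>a\<in>A. v x a *\<^sub>R w a) ` X)"
    unfolding Q by (simp add: convex_hull_linear_image[OF \<open>linear L\<close>] image_image L_vec)
  moreover have "affine_map L"
    unfolding affine_map_def using \<open>linear L\<close> by (intro exI[of _ L] exI[of _ 0]) simp
  moreover have "polytope (solution_set S)"
    unfolding polytope_def Q using \<open>finite X\<close> by blast
  ultimately have "extended_formulation S (convex hull ((\<lambda>x. \<Sum>a\<in>A. v x a *\<^sub>R w a) ` X))"
    unfolding extended_formulation_def extension_of_def by blast
  moreover have "formulation_size S = card A"
    by (simp add: formulation_size_def S_def)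
  ultimately show ?thesis by blast
qed


section \<open>Flows in the layered network of partial sums\<close>

definition arcs :: "'a set \<Rightarrow> (nat \<Rightarrow> 'a set) \<Rightarrow> nat \<Rightarrow> (nat \<times> 'a \<times> 'a) set" where
  "arcs V B n = (SIGMA i:{..<n}. V \<times> B i)"

text \<open>
  The coefficients of the flow conservation equation at node \<open>(k, s)\<close>: flow out minus flow
  in.
\<close>

definition excess :: "nat \<Rightarrow> 'a::monoid_add \<Rightarrow> nat \<times> 'a \<times> 'a \<Rightarrow> real" where
  "excess k s = (\<lambda>(i, t, \<omega>). of_bool (i = k \<and> t = s) - of_bool (Suc i = k \<and> t + \<omega> = s))"

definition path_arc :: "'a::monoid_add list \<Rightarrow> nat \<Rightarrow> nat \<times> 'a \<times> 'a" where
  "path_arc \<xi> i = (i, sum_list (take i \<xi>), \<xi> ! i)"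

definition path_flow :: "'a::monoid_add list \<Rightarrow> nat \<times> 'a \<times> 'a \<Rightarrow> real" where
  "path_flow \<xi> a = of_bool (a \<in> path_arc \<xi> ` {..<length \<xi>})"

definition transversals :: "(nat \<Rightarrow> 'a set) \<Rightarrow> nat \<Rightarrow> 'a list set" where
  "transversals B k = {\<xi>. length \<xi> = k \<and> (\<forall>i<k. \<xi> ! i \<in> B i)}"

lemma finite_arcs: "finite V \<Longrightarrow> (\<And>i. i < n \<Longrightarrow> finite (B i)) \<Longrightarrow> finite (arcs V B n)"
  unfolding arcs_def by auto

lemma sum_arcs:
  assumes "finite V" "\<And>i. i < n \<Longrightarrow> finite (B i)"
  shows "sum f (arcs V B n) = (\<Sum>i<n. \<Sum>t\<in>V. \<Sum>\<omega>\<in>B i. f (i, t, \<omega>))"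
proof -
  have "(\<Sum>i<n. \<Sum>p\<in>V \<times> B i. f (i, p)) = (\<Sum>(i, p)\<in>arcs V B n. f (i, p))"
    unfolding arcs_def by (rule sum.Sigma) (use assms in auto)
  then show ?thesis
    by (simp add: sum.cartesian_product)
qed

lemma card_arcs:
  assumes "finite V" "\<And>i. i < n \<Longrightarrow> finite (B i)"
  shows "card (arcs V B n) = card V * (\<Sum>i<n. card (B i))"
  unfolding arcs_def using assms
  by (subst card_SigmaI) (auto simp: card_cartesian_product sum_distrib_left)

lemma transversals_0: "transversals B 0 = {[]}"
  by (auto simp: transversals_def)

lemma bij_betw_transversals_Suc:
  "bij_betw (\<lambda>(\<xi>, \<omega>). \<xi> @ [\<omega>]) (transversals B k \<times> B k) (transversals B (Suc k))"
  unfolding bij_betw_def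
proof
  show "inj_on (\<lambda>(\<xi>, \<omega>). \<xi> @ [\<omega>]) (transversals B k \<times> B k)"
    by (auto simp: inj_on_def)
  show "(\<lambda>(\<xi>, \<omega>). \<xi> @ [\<omega>]) ` (transversals B k \<times> B k) = transversals B (Suc k)"
  proof
    show "(\<lambda>(\<xi>, \<omega>). \<xi> @ [\<omega>]) ` (transversals B k \<times> B k) \<subseteq> transversals B (Suc k)"
      by (auto simp: transversals_def nth_append less_Suc_eq)
    show "transversals B (Suc k) \<subseteq> (\<lambda>(\<xi>, \<omega>). \<xi> @ [\<omega>]) ` (transversals B k \<times> B k)"
    proof
      fix \<eta> assume \<eta>: "\<eta> \<in> transversals B (Suc k)"
      then have "\<eta> = butlast \<eta> @ [last \<eta>]"
        by (intro append_butlast_last_id[symmetric]) (auto simp: transversals_def)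
      moreover have "butlast \<eta> \<in> transversals B k" "last \<eta> \<in> B k"
        using \<eta> by (auto simp: transversals_def nth_butlast last_conv_nth simp flip: length_greater_0_conv)
      ultimately show "\<eta> \<in> (\<lambda>(\<xi>, \<omega>). \<xi> @ [\<omega>]) ` (transversals B k \<times> B k)"
        by force
    qed
  qed
qed

lemma sum_transversals_Suc:
  "sum f (transversals B (Suc k)) = (\<Sum>\<xi>\<in>transversals B k. \<Sum>\<omega>\<in>B k. f (\<xi> @ [\<omega>]))"
  by (subst sum.reindex_bij_betw[OF bij_betw_transversals_Suc, symmetric])
    (simp add: sum.cartesian_product case_prod_unfold)

lemma finite_transversals:
  "(\<And>i. i < n \<Longrightarrow> finite (B i)) \<Longrightarrow> finite (transversals B n)"
proof (induction n)
  case 0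
  then show ?case by (simp add: transversals_0)
next
  case (Suc n)
  then show ?case
    using bij_betw_finite[OF bij_betw_transversals_Suc, of B n] by simp
qed

lemma sum_list_take_in:
  assumes "0 \<in> V" "\<forall>i<n. \<forall>s\<in>V. \<forall>\<omega>\<in>B i. s + \<omega> \<in> V"
    and \<xi>: "\<xi> \<in> transversals B n" and "k \<le> n"
  shows "sum_list (take k \<xi>) \<in> V"
  using \<open>k \<le> n\<close>
proof (induction k)
  case 0
  then show ?case using assms by simp
next
  case (Suc k)
  then have "k < n" "sum_list (take k \<xi>) \<in> V" "\<xi> ! k \<in> B k" "length \<xi> = n"
    using \<xi> by (auto simp: transversals_def)
  then show ?case
    using assms(2) by (simp add: take_Suc_conv_app_nth)
qed

text \<open>A path meets each layer in exactly one arc, so summing against its flow is summing along the path.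
  Closedness of \<open>V\<close> keeps the path inside the network.\<close>

lemma sum_path_flow:
  fixes f :: "nat \<times> 'a::monoid_add \<times> 'a \<Rightarrow> 'b::real_vector"
  assumes "0 \<in> V" "\<forall>i<n. \<forall>s\<in>V. \<forall>\<omega>\<in>B i. s + \<omega> \<in> V"
    and fin: "finite V" "\<And>i. i < n \<Longrightarrow> finite (B i)"
    and \<xi>: "\<xi> \<in> transversals B n"
  shows "(\<Sum>a\<in>arcs V B n. path_flow \<xi> a *\<^sub>R f a) = (\<Sum>i<n. f (path_arc \<xi> i))"
proof -
  have len: "length \<xi> = n" using \<xi> by (simp add: transversals_def)
  have sub: "path_arc \<xi> ` {..<n} \<subseteq> arcs V B n"
  proof
    fix a assume "a \<in> path_arc \<xi> ` {..<n}"
    then obtain i where i: "i < n" "a = path_arc \<xi> i" by auto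
    have "sum_list (take i \<xi>) \<in> V"
      by (rule sum_list_take_in[of V n B]) (use assms i in auto)
    then show "a \<in> arcs V B n"
      using \<xi> i by (simp add: path_arc_def arcs_def transversals_def)
  qed
  have "(\<Sum>a\<in>arcs V B n. path_flow \<xi> a *\<^sub>R f a) = (\<Sum>a\<in>path_arc \<xi> ` {..<n}. f a)"
    by (rule sum.mono_neutral_cong_right) (use sub fin in \<open>auto simp: path_flow_def len finite_arcs\<close>)
  also have "\<dots> = (\<Sum>i<n. f (path_arc \<xi> i))"
    by (rule sum.reindex_cong[OF _ refl refl]) (auto simp: inj_on_def path_arc_def)
  finally show ?thesis .
qed

text \<open>Along a path, the indicator of being at node \<open>(k, s)\<close> before step \<open>i\<close> minus
  the same indicator after step \<open>i\<close> telescopes, so only the start and the end of the path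
  contribute.\<close>

lemma excess_path_flow:
  assumes "0 \<in> V" "\<forall>i<n. \<forall>s\<in>V. \<forall>\<omega>\<in>B i. s + \<omega> \<in> V"
    and fin: "finite V" "\<And>i. i < n \<Longrightarrow> finite (B i)"
    and \<xi>: "\<xi> \<in> transversals B n"
  shows "(\<Sum>a\<in>arcs V B n. excess k s a * path_flow \<xi> a) =
         of_bool (0 = k \<and> 0 = s) - of_bool (n = k \<and> sum_list \<xi> = s)"
proof -
  have len: "length \<xi> = n" using \<xi> by (simp add: transversals_def)
  have "(\<Sum>a\<in>arcs V B n. excess k s a * path_flow \<xi> a) = (\<Sum>i<n. excess k s (path_arc \<xi> i))"
    using sum_path_flow[where f = "excess k s", OF assms] by (simp add: mult.commute)
  also have "\<dots> = (\<Sum>i<n. of_bool (i = k \<and> sum_list (take i \<xi>) = s) -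
                     of_bool (Suc i = k \<and> sum_list (take (Suc i) \<xi>) = s))"
    by (rule sum.cong) (auto simp: excess_def path_arc_def len take_Suc_conv_app_nth)
  also have "\<dots> = of_bool (0 = k \<and> 0 = s) - of_bool (n = k \<and> sum_list \<xi> = s)"
    by (subst sum_lessThan_telescope') (simp add: len)
  finally show ?thesis .
qed

text \<open>Only the layers \<open>k - 1\<close> and \<open>k\<close> touch a node \<open>(k, s)\<close>.  Cutting the
  network off before layer \<open>k\<close> therefore loses just the outflow of the node, which makes
  the balance equation accessible to an induction on the number of layers.\<close>

lemma excess_truncate:
  assumes fin: "finite V" "\<And>i. i < n \<Longrightarrow> finite (B i)"
    and "s \<in> V" "k < n"
  shows "(\<Sum>a\<in>arcs V B n. excess k s a * z a) =
         (\<Sum>a\<in>arcs V B k. excess k s a * z a) + (\<Sum>\<omega>\<in>B k. z (k, s, \<omega>))"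
proof -
  let ?h = "\<lambda>i. \<Sum>t\<in>V. \<Sum>\<omega>\<in>B i. excess k s (i, t, \<omega>) * z (i, t, \<omega>)"
  have "(\<Sum>a\<in>arcs V B n. excess k s a * z a) = (\<Sum>i<n. ?h i)"
    using fin by (rule sum_arcs)
  also have "\<dots> = (\<Sum>i<Suc k. ?h i)"
    by (rule sum.mono_neutral_right) (use \<open>k < n\<close> in \<open>auto simp: excess_def intro!: sum.neutral\<close>)
  also have "\<dots> = (\<Sum>i<k. ?h i) + ?h k" by simp
  also have "?h k = (\<Sum>t\<in>V. if t = s then (\<Sum>\<omega>\<in>B k. z (k, t, \<omega>)) else 0)"
    by (intro sum.cong) (auto simp: excess_def)
  also have "\<dots> = (\<Sum>\<omega>\<in>B k. z (k, s, \<omega>))"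
    using \<open>s \<in> V\<close> fin by simp
  also have "(\<Sum>i<k. ?h i) = (\<Sum>a\<in>arcs V B k. excess k s a * z a)"
    using fin \<open>k < n\<close> by (subst sum_arcs) auto
  finally show ?thesis .
qed

text \<open>Linear extension of the telescoping identity: apart from the unit supplied at the source, the
  excess at a node of the last level is minus the total weight of the paths that end there.\<close>

lemma excess_path_combination:
  assumes "0 \<in> V" "\<forall>i<n. \<forall>s\<in>V. \<forall>\<omega>\<in>B i. s + \<omega> \<in> V"
    and fin: "finite V" "\<And>i. i < n \<Longrightarrow> finite (B i)"
    and total: "sum \<mu> (transversals B n) = 1"
    and z: "\<And>a. a \<in> arcs V B n \<Longrightarrow> z a = (\<Sum>\<xi>\<in>transversals B n. \<mu> \<xi> * path_flow \<xi> a)"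
  shows "(\<Sum>a\<in>arcs V B n. excess k s a * z a) = of_bool (0 = k \<and> 0 = s) -
           (\<Sum>\<xi>\<in>transversals B n. \<mu> \<xi> * of_bool (n = k \<and> sum_list \<xi> = s))"
proof -
  have "(\<Sum>a\<in>arcs V B n. excess k s a * z a) =
        (\<Sum>a\<in>arcs V B n. \<Sum>\<xi>\<in>transversals B n. \<mu> \<xi> * (excess k s a * path_flow \<xi> a))"
    by (rule sum.cong) (auto simp: z sum_distrib_left intro!: sum.cong)
  also have "\<dots> = (\<Sum>\<xi>\<in>transversals B n. \<mu> \<xi> * (\<Sum>a\<in>arcs V B n. excess k s a * path_flow \<xi> a))"
    by (subst sum.swap) (simp add: sum_distrib_left)
  also have "\<dots> = (\<Sum>\<xi>\<in>transversals B n. \<mu> \<xi> *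
                    (of_bool (0 = k \<and> 0 = s) - of_bool (n = k \<and> sum_list \<xi> = s)))"
    by (rule sum.cong[OF refl]) (simp only: excess_path_flow[OF assms(1-4)])
  also have "\<dots> = of_bool (0 = k \<and> 0 = s) -
           (\<Sum>\<xi>\<in>transversals B n. \<mu> \<xi> * of_bool (n = k \<and> sum_list \<xi> = s))"
    by (simp only: right_diff_distrib sum_subtractf flip: sum_distrib_right) (simp add: total)
  finally show ?thesis .
qed

text \<open>Induction on the number of layers, extending each path of weight \<open>\<mu>\<close> that ends in
  \<open>s\<close> by all arcs out of \<open>(k, s)\<close>, with the weight split in proportion to the flow
  on these arcs.  The balance equation says that the paths ending in \<open>s\<close> have as total weight
  the outflow of \<open>(k, s)\<close>, so that the new arcs receive the right flow.\<close>

lemma flow_decomposition_layer: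
  assumes "0 \<in> V" "\<forall>i<n. \<forall>s\<in>V. \<forall>\<omega>\<in>B i. s + \<omega> \<in> V"
    and fin: "finite V" "\<And>i. i < n \<Longrightarrow> finite (B i)"
    and nonneg: "\<And>a. a \<in> arcs V B n \<Longrightarrow> z a \<ge> 0"
    and cons: "\<And>k s. k < n \<Longrightarrow> s \<in> V \<Longrightarrow>
      (\<Sum>a\<in>arcs V B n. excess k s a * z a) = of_bool (0 = k \<and> 0 = s)"
    and "k \<le> n"
  shows "\<exists>\<mu>. (\<forall>\<xi>\<in>transversals B k. \<mu> \<xi> \<ge> 0) \<and> sum \<mu> (transversals B k) = 1 \<and>
             (\<forall>a\<in>arcs V B k. z a = (\<Sum>\<xi>\<in>transversals B k. \<mu> \<xi> * path_flow \<xi> a))"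
  using \<open>k \<le> n\<close>
proof (induction k)
  case 0
  show ?case by (rule exI[of _ "\<lambda>_. 1"]) (simp add: transversals_0 arcs_def)
next
  case (Suc k)
  then have "k < n" by simp
  let ?T = "transversals B k"
  obtain \<mu> where \<mu>: "\<And>\<xi>. \<xi> \<in> ?T \<Longrightarrow> \<mu> \<xi> \<ge> 0" "sum \<mu> ?T = 1"
    "\<And>a. a \<in> arcs V B k \<Longrightarrow> z a = (\<Sum>\<xi>\<in>?T. \<mu> \<xi> * path_flow \<xi> a)"
    using Suc by auto
  have closed_k: "\<forall>i<k. \<forall>s\<in>V. \<forall>\<omega>\<in>B i. s + \<omega> \<in> V"
    using assms(2) \<open>k < n\<close> less_trans by blast
  have finT: "finite ?T"
    by (rule finite_transversals) (use fin \<open>k < n\<close> in auto)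
  define out where "out s = (\<Sum>\<omega>\<in>B k. z (k, s, \<omega>))" for s
  have out: "out s = (\<Sum>\<xi>\<in>?T. \<mu> \<xi> * of_bool (sum_list \<xi> = s))" if "s \<in> V" for s
  proof -
    have "(\<Sum>a\<in>arcs V B k. excess k s a * z a) = of_bool (0 = k \<and> 0 = s) -
           (\<Sum>\<xi>\<in>?T. \<mu> \<xi> * of_bool (k = k \<and> sum_list \<xi> = s))"
      by (rule excess_path_combination) (use assms(1) closed_k fin \<mu> \<open>k < n\<close> in auto)
    moreover have "(\<Sum>a\<in>arcs V B n. excess k s a * z a) =
         (\<Sum>a\<in>arcs V B k. excess k s a * z a) + out s"
      unfolding out_def by (rule excess_truncate) (use fin that \<open>k < n\<close> in auto)
    ultimately show ?thesis
      using cons[OF \<open>k < n\<close> that] by simp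
  qed
  have inV: "sum_list \<xi> \<in> V" if "\<xi> \<in> ?T" for \<xi>
  proof -
    have "sum_list (take k \<xi>) \<in> V"
      by (rule sum_list_take_in[of V k B]) (use assms(1) closed_k that in auto)
    then show ?thesis using that by (simp add: transversals_def)
  qed
  have znn: "z (k, s, \<omega>) \<ge> 0" if "s \<in> V" "\<omega> \<in> B k" for s \<omega>
    using nonneg that \<open>k < n\<close> by (simp add: arcs_def)
  have out_nn: "out s \<ge> 0" if "s \<in> V" for s
    unfolding out_def by (rule sum_nonneg) (use znn that in auto)
  (* A node without outflow is not the end of any path of positive weight; hence dividing by zero
     below, which gives 0, distributes the weight correctly there as well. *)
  have \<mu>0: "\<mu> \<xi> = 0" if "\<xi> \<in> ?T" "out (sum_list \<xi>) = 0" for \<xi>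
  proof -
    have "(\<Sum>\<eta>\<in>?T. \<mu> \<eta> * of_bool (sum_list \<eta> = sum_list \<xi>)) = 0"
      using out[OF inV[OF that(1)]] that(2) by simp
    then have "\<mu> \<xi> * of_bool (sum_list \<xi> = sum_list \<xi>) = 0"
      using finT \<mu>(1) that(1) by (subst (asm) sum_nonneg_eq_0_iff) auto
    then show ?thesis by simp
  qed
  define \<nu> where "\<nu> \<eta> = \<mu> (butlast \<eta>) *
      (z (k, sum_list (butlast \<eta>), last \<eta>) / out (sum_list (butlast \<eta>)))" for \<eta>
  have \<nu>_snoc: "\<nu> (\<xi> @ [\<omega>]) = \<mu> \<xi> * (z (k, sum_list \<xi>, \<omega>) / out (sum_list \<xi>))" for \<xi> \<omega>
    by (simp add: \<nu>_def)
  have \<nu>_extend: "(\<Sum>\<omega>\<in>B k. \<nu> (\<xi> @ [\<omega>])) = \<mu> \<xi>" if "\<xi> \<in> ?T" for \<xi>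
  proof -
    have "(\<Sum>\<omega>\<in>B k. \<nu> (\<xi> @ [\<omega>])) = \<mu> \<xi> * (out (sum_list \<xi>) / out (sum_list \<xi>))"
      by (simp only: \<nu>_snoc out_def sum_divide_distrib sum_distrib_left)
    then show ?thesis using \<mu>0[OF that] by (cases "out (sum_list \<xi>) = 0") auto
  qed
  have "\<nu> \<eta> \<ge> 0" if \<eta>: "\<eta> \<in> transversals B (Suc k)" for \<eta>
  proof -
    obtain \<xi> \<omega> where "\<eta> = \<xi> @ [\<omega>]" "\<xi> \<in> ?T" "\<omega> \<in> B k"
      using \<eta> bij_betw_imp_surj_on[OF bij_betw_transversals_Suc[of B k], symmetric] by auto
    then show ?thesis
      by (simp add: \<nu>_snoc \<mu> znn out_nn inV)
  qed
  moreover have "sum \<nu> (transversals B (Suc k)) = 1"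
    by (simp add: sum_transversals_Suc \<nu>_extend \<mu>)
  moreover have "z a = (\<Sum>\<eta>\<in>transversals B (Suc k). \<nu> \<eta> * path_flow \<eta> a)"
    if a: "a \<in> arcs V B (Suc k)" for a
  proof -
    obtain i s \<omega> where a_eq: "a = (i, s, \<omega>)" by (cases a)
    have s: "s \<in> V" "\<omega> \<in> B i" "i < Suc k" using a by (auto simp: arcs_def a_eq)
    have flow: "path_flow \<xi> a = of_bool (i < length \<xi> \<and> sum_list (take i \<xi>) = s \<and> \<xi> ! i = \<omega>)" for \<xi>
      by (auto simp: path_flow_def path_arc_def a_eq)
    show ?thesis
    proof (cases "i = k")
      case False
      then have "i < k" using s by simp
      then have "path_flow (\<xi> @ [\<omega>']) a = path_flow \<xi> a" if "\<xi> \<in> ?T" for \<xi> \<omega>'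
        using that by (auto simp: flow transversals_def nth_append)
      then have "(\<Sum>\<eta>\<in>transversals B (Suc k). \<nu> \<eta> * path_flow \<eta> a) =
          (\<Sum>\<xi>\<in>?T. \<mu> \<xi> * path_flow \<xi> a)"
        by (simp add: sum_transversals_Suc \<nu>_extend flip: sum_distrib_right)
      also have "\<dots> = z a"
        using \<open>i < k\<close> s by (intro \<mu>(3)[symmetric]) (simp add: a_eq arcs_def)
      finally show ?thesis by simp
    next
      case True
      have \<omega>: "\<omega> \<in> B k" "finite (B k)" using s True fin \<open>k < n\<close> by auto
      have "(\<Sum>\<eta>\<in>transversals B (Suc k). \<nu> \<eta> * path_flow \<eta> a) =
          (\<Sum>\<xi>\<in>?T. \<Sum>\<omega>'\<in>B k. \<nu> (\<xi> @ [\<omega>']) * of_bool (sum_list \<xi> = s \<and> \<omega>' = \<omega>))"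
        unfolding sum_transversals_Suc
        by (intro sum.cong) (auto simp: flow True transversals_def)
      also have "\<dots> = (\<Sum>\<xi>\<in>?T. \<nu> (\<xi> @ [\<omega>]) * of_bool (sum_list \<xi> = s))"
      proof (rule sum.cong[OF refl])
        fix \<xi>
        have "(\<Sum>\<omega>'\<in>B k. \<nu> (\<xi> @ [\<omega>']) * of_bool (sum_list \<xi> = s \<and> \<omega>' = \<omega>)) =
          (\<Sum>\<omega>'\<in>B k. if \<omega>' = \<omega> then \<nu> (\<xi> @ [\<omega>']) * of_bool (sum_list \<xi> = s) else 0)"
          by (rule sum.cong) auto
        then show "(\<Sum>\<omega>'\<in>B k. \<nu> (\<xi> @ [\<omega>']) * of_bool (sum_list \<xi> = s \<and> \<omega>' = \<omega>)) =
           \<nu> (\<xi> @ [\<omega>]) * of_bool (sum_list \<xi> = s)"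
          using \<omega> by simp
      qed
      also have "\<dots> = (\<Sum>\<xi>\<in>?T. (\<mu> \<xi> * of_bool (sum_list \<xi> = s)) * (z (k, s, \<omega>) / out s))"
        by (intro sum.cong) (auto simp: \<nu>_snoc)
      also have "\<dots> = out s * (z (k, s, \<omega>) / out s)"
        unfolding sum_distrib_right[symmetric] out[OF s(1), symmetric] ..
      also have "\<dots> = z a"
      proof (cases "out s = 0")
        case 0: True
        then have "z (k, s, \<omega>) = 0"
          unfolding out_def using \<omega> znn[OF s(1)] by (subst (asm) sum_nonneg_eq_0_iff) auto
        then show ?thesis by (simp add: a_eq True)
      qed (simp add: a_eq True)
      finally show ?thesis by simp
    qed
  qed
  ultimately show ?case by blast
qed

text \<open>The balance equations at the last level say that no weight ends at a node \<open>(n, s)\<close> with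
  \<open>s \<noteq> 0\<close>; as weights are nonnegative, only the transversals with sum zero carry any.\<close>

lemma flow_decomposition:
  assumes "0 \<in> V" "\<forall>i<n. \<forall>s\<in>V. \<forall>\<omega>\<in>B i. s + \<omega> \<in> V"
    and fin: "finite V" "\<And>i. i < n \<Longrightarrow> finite (B i)"
    and nonneg: "\<And>a. a \<in> arcs V B n \<Longrightarrow> z a \<ge> 0"
    and cons: "\<And>k s. k \<le> n \<Longrightarrow> s \<in> V \<Longrightarrow>
      (\<Sum>a\<in>arcs V B n. excess k s a * z a) = of_bool (0 = k \<and> 0 = s) - of_bool (n = k \<and> 0 = s)"
  defines "C \<equiv> {\<xi> \<in> transversals B n. sum_list \<xi> = 0}"
  shows "\<exists>\<mu>. (\<forall>\<xi>\<in>C. \<mu> \<xi> \<ge> 0) \<and> sum \<mu> C = 1 \<and>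
             (\<forall>a\<in>arcs V B n. z a = (\<Sum>\<xi>\<in>C. \<mu> \<xi> * path_flow \<xi> a))"
proof -
  let ?T = "transversals B n"
  have "\<exists>\<mu>. (\<forall>\<xi>\<in>?T. \<mu> \<xi> \<ge> 0) \<and> sum \<mu> ?T = 1 \<and>
             (\<forall>a\<in>arcs V B n. z a = (\<Sum>\<xi>\<in>?T. \<mu> \<xi> * path_flow \<xi> a))"
  proof (rule flow_decomposition_layer[OF assms(1,2) fin nonneg])
    show "(\<Sum>a\<in>arcs V B n. excess k s a * z a) = of_bool (0 = k \<and> 0 = s)"
      if "k < n" "s \<in> V" for k s
      using cons[of k s] that by simp
  qed auto
  then obtain \<mu> where \<mu>: "\<And>\<xi>. \<xi> \<in> ?T \<Longrightarrow> \<mu> \<xi> \<ge> 0" "sum \<mu> ?T = 1"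
    "\<And>a. a \<in> arcs V B n \<Longrightarrow> z a = (\<Sum>\<xi>\<in>?T. \<mu> \<xi> * path_flow \<xi> a)" by blast
  have finT: "finite ?T" using fin by (auto intro: finite_transversals)
  have \<mu>0: "\<mu> \<xi> = 0" if "\<xi> \<in> ?T - C" for \<xi>
  proof -
    have \<xi>: "\<xi> \<in> ?T" "sum_list \<xi> \<noteq> 0" using that by (auto simp: C_def)
    have V: "sum_list \<xi> \<in> V"
      using sum_list_take_in[OF assms(1,2) \<xi>(1), of n] \<xi>(1) by (simp add: transversals_def)
    have "(\<Sum>a\<in>arcs V B n. excess n (sum_list \<xi>) a * z a) = of_bool (0 = n \<and> 0 = sum_list \<xi>) -
           (\<Sum>\<eta>\<in>?T. \<mu> \<eta> * of_bool (n = n \<and> sum_list \<eta> = sum_list \<xi>))"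
      by (rule excess_path_combination) (use assms \<mu> in auto)
    then have "(\<Sum>\<eta>\<in>?T. \<mu> \<eta> * of_bool (sum_list \<eta> = sum_list \<xi>)) = 0"
      using cons[OF order_refl V] \<xi>(2) by simp
    then have "\<mu> \<xi> * of_bool (sum_list \<xi> = sum_list \<xi>) = 0"
      using finT \<mu>(1) \<xi>(1) by (subst (asm) sum_nonneg_eq_0_iff) auto
    then show ?thesis by simp
  qed
  have restrict: "(\<Sum>\<xi>\<in>?T. \<mu> \<xi> * h \<xi>) = (\<Sum>\<xi>\<in>C. \<mu> \<xi> * h \<xi>)" for h :: "'a list \<Rightarrow> real"
    by (rule sum.mono_neutral_right) (use finT \<mu>0 in \<open>auto simp: C_def\<close>)
  show ?thesis
    using \<mu> restrict[of "\<lambda>_. 1"] by (intro exI[of _ \<mu>]) (auto simp: restrict C_def)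
qed


section \<open>The formulation of the cyclic transversal polytope\<close>

text \<open>The only coefficients are 0 and 1, so the elements of the span are the sums of the subsets of a
  basis.\<close>

lemma card_span_le:
  fixes X :: "(bit ^ 'd) set"
  shows "card (vec.span X) \<le> 2 ^ vec.dim (vec.span X)"
proof -
  obtain D where D: "D \<subseteq> vec.span X" "vec.span X \<subseteq> vec.span D" "card D = vec.dim (vec.span X)"
    using vec.basis_exists[of "vec.span X"] by metis
  have "vec.span D \<subseteq> (\<lambda>S. \<Sum>S) ` Pow D"
  proof
    fix y assume "y \<in> vec.span D"
    then obtain u where y: "y = (\<Sum>d\<in>D. u d *s d)"
      by (auto simp: vec.span_finite)
    have "u d *s d = (if u d = 1 then d else 0)" for d
      by (cases "u d") auto
    then have "y = \<Sum>{d \<in> D. u d = 1}"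
      by (simp add: y sum.inter_filter)
    then show "y \<in> (\<lambda>S. \<Sum>S) ` Pow D" by blast
  qed
  then have "card (vec.span X) \<le> card ((\<lambda>S. \<Sum>S) ` Pow D)"
    using D(2) by (intro card_mono) auto
  also have "\<dots> \<le> card (Pow D)" by (rule card_image_le) simp
  finally show ?thesis by (simp add: card_Pow D(3))
qed

lemma cyclic_transversals_eq:
  "cyclic_transversals \<B> = {\<xi> \<in> transversals ((!) \<B>) (length \<B>). sum_list \<xi> = 0}"
  by (auto simp: cyclic_transversals_def transversals_def sum_list_sum_nth atLeast0LessThan)

lemma incidence_vector_eq_sum:
  "incidence_vector \<xi> = (\<Sum>i<length \<xi>. Poly_Mapping.single (i, \<xi> ! i) 1)"
proof (rule poly_mapping_eqI)
  fix k :: "nat \<times> (bit ^ 'a)"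
  obtain i \<omega> where k: "k = (i, \<omega>)" by (cases k)
  have "(\<Sum>j<length \<xi>. Poly_Mapping.lookup (Poly_Mapping.single (j, \<xi> ! j) (1::real)) k) =
        (\<Sum>j<length \<xi>. if j = i then of_bool (\<xi> ! i = \<omega>) else 0)"
    by (rule sum.cong) (auto simp: lookup_single when_def k)
  then show "Poly_Mapping.lookup (incidence_vector \<xi>) k =
      Poly_Mapping.lookup (\<Sum>i<length \<xi>. Poly_Mapping.single (i, \<xi> ! i) 1) k"
    by (simp add: lookup_sum k lookup_incidence_vector)
qed

theorem theorem6p1:
  fixes \<B> :: "(bit ^ 'd) set list"
  assumes "block_configuration \<B>"
  shows "\<exists>S. extended_formulation S (CTP \<B>) \<and>
             formulation_size S \<le> 2 ^ config_rank \<B> * config_size \<B>"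
proof -
  define n where "n = length \<B>"
  define B where "B = (!) \<B>"
  define V where "V = vec.span (\<Union>i<n. B i)"
  define A where "A = arcs V B n"
  define C where "C = cyclic_transversals \<B>"
  have C_eq: "C = {\<xi> \<in> transversals B n. sum_list \<xi> = 0}"
    by (simp add: C_def cyclic_transversals_eq B_def n_def)
  have V0: "0 \<in> V" by (simp add: V_def vec.span_zero)
  have V_add: "\<forall>i<n. \<forall>s\<in>V. \<forall>\<omega>\<in>B i. s + \<omega> \<in> V"
    unfolding V_def by (auto intro!: vec.span_add intro: vec.span_base)
  have fin: "finite V" "\<And>i. i < n \<Longrightarrow> finite (B i)" by simp_all
  define w :: "nat \<times> (bit ^ 'd) \<times> (bit ^ 'd) \<Rightarrow> (nat \<times> (bit ^ 'd)) \<Rightarrow>\<^sub>0 real"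
    where "w = (\<lambda>(i, s, \<omega>). Poly_Mapping.single (i, \<omega>) 1)"
  have "\<exists>S. extended_formulation S (convex hull ((\<lambda>\<xi>. \<Sum>a\<in>A. path_flow \<xi> a *\<^sub>R w a) ` C)) \<and>
             formulation_size S = card A"
  proof (rule extended_formulation_standard_form)
    show "finite A" unfolding A_def using fin by (rule finite_arcs)
    show "finite ({..n} \<times> V)" by simp
    have "finite (transversals B n)" using fin(2) by (rule finite_transversals)
    then show "finite C" by (simp add: C_eq)
    show "path_flow \<xi> a \<ge> 0" for \<xi> :: "(bit ^ 'd) list" and a
      by (simp add: path_flow_def)
    show "(\<Sum>a\<in>A. (\<lambda>(k, s). excess k s) p a * path_flow \<xi> a) =
        (\<lambda>(k, s). of_bool (0 = k \<and> 0 = s) - of_bool (n = k \<and> 0 = s)) p"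
      if "\<xi> \<in> C" for \<xi> p
      using that excess_path_flow[OF V0 V_add fin, where \<xi> = \<xi>]
      by (auto simp: A_def C_eq split: prod.split)
    show "\<exists>\<mu>. (\<forall>\<xi>\<in>C. \<mu> \<xi> \<ge> 0) \<and> sum \<mu> C = 1 \<and> (\<forall>a\<in>A. z a = (\<Sum>\<xi>\<in>C. \<mu> \<xi> * path_flow \<xi> a))"
      if nonneg: "\<And>a. a \<in> A \<Longrightarrow> z a \<ge> 0"
        and cons: "\<And>p. p \<in> {..n} \<times> V \<Longrightarrow> (\<Sum>a\<in>A. (\<lambda>(k, s). excess k s) p a * z a) =
          (\<lambda>(k, s). of_bool (0 = k \<and> 0 = s) - of_bool (n = k \<and> 0 = s)) p" for z
      unfolding C_eq A_def
      by (rule flow_decomposition[OF V0 V_add fin]) (use nonneg cons in \<open>auto simp: A_def\<close>)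
  qed
  moreover have "(\<Sum>a\<in>A. path_flow \<xi> a *\<^sub>R w a) = incidence_vector \<xi>" if "\<xi> \<in> C" for \<xi>
  proof -
    have \<xi>: "\<xi> \<in> transversals B n" using that by (simp add: C_eq)
    have "(\<Sum>a\<in>A. path_flow \<xi> a *\<^sub>R w a) = (\<Sum>i<n. w (path_arc \<xi> i))"
      unfolding A_def using V0 V_add fin \<xi> by (rule sum_path_flow)
    also have "\<dots> = incidence_vector \<xi>"
      using \<xi> by (simp add: incidence_vector_eq_sum w_def path_arc_def transversals_def)
    finally show ?thesis .
  qed
  ultimately obtain S where S: "extended_formulation S (CTP \<B>)" "formulation_size S = card A"
    by (auto simp: CTP_def C_def cong: image_cong)
  have "card A = card V * config_size \<B>"
    unfolding A_def by (subst card_arcs[OF fin]) (simp_all add: config_size_def B_def n_def)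
  also have "\<dots> \<le> 2 ^ config_rank \<B> * config_size \<B>"
    using card_span_le by (intro mult_right_mono) (simp_all add: V_def config_rank_def B_def n_def)
  finally show ?thesis using S by auto
qed

end
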